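(* Let $H$ be a nontrivial finitely generated group and let $K$ be an infinite finitely generated group. Let $G = H \wr K$ and let $S, T$ be any finite symmetric generating sets of $G$, both containing the identity $e_G$. Then there exists an $S$-horoball $P \subset G$ which is $T$-disconnected, i.e. not $T$-connected.
   Context: $H \wr K = \left(\bigoplus_{K} H\right) \rtimes K$ is the restricted wreath product, with $K$ acting on the direct sum by translation of coordinates. All generating sets are finite, symmetric ($S = \{s^{-1} : s\in S\}$) and contain the identity. For a group $G$ with generating set $S$, $|g|_S$ is the minimal $\ell \ge 0$ such that $g$ is a product of $\ell$ elements of $S$, the word metric is $d_S(g,h) = |g^{-1}h|_S$ (left-invariant), and $B_{S,r}(g) = \{h \in G : d_S(g,h)\le r\}$. Subsets of $G$ are identified with elements of $\{0,1\}^G$ with the product (Cantor) topology, so $P_i \to P$ means that for each $g\in G$, $g \in P_i \iff g \in P$ for all large $i$. An $S$-horoball is a set $P \subset G$ with $P \ne \emptyset$, $P\neq G$, such that $P = \lim_i B_{S,n_i}(g_i)$ for some $g_i \in G$ and $n_i \in \mathbb{N}$ with $n_i \to \infty$. A subset $A \subset G$ is $T$-connected if any two elements $g,g'$ of $A$ are joined by a finite sequence $g=g_0, g_1, \dots, g_k=g'$ of elements of $A$ with $g_{i+1} \in g_i T$ for all $0\le i<k$. *)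

theory Defs
  imports "HOL-Algebra.Algebra"
begin

definition finitely_generated_group :: "('a, 'm) monoid_scheme \<Rightarrow> bool" where
  "finitely_generated_group G \<longleftrightarrow>
     group G \<and> (\<exists>S. finite S \<and> S \<subseteq> carrier G \<and> generate G S = carrier G)"

definition symmetric_generating_set :: "('a, 'm) monoid_scheme \<Rightarrow> 'a set \<Rightarrow> bool" where
  "symmetric_generating_set G S \<longleftrightarrow>
     finite S \<and> S \<subseteq> carrier G \<and> S = m_inv G ` S \<and> \<one>\<^bsub>G\<^esub> \<in> S \<and> generate G S = carrier G"

(* \<phi> is the left action of Q on N by automorphisms. *)
definition semidirect_product ::
    "('a, 'm) monoid_scheme \<Rightarrow> ('b, 'n) monoid_scheme \<Rightarrow> ('b \<Rightarrow> 'a \<Rightarrow> 'a) \<Rightarrow> ('a \<times> 'b) monoid" where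
  "semidirect_product N Q \<phi> =
     \<lparr>carrier = carrier N \<times> carrier Q,
      monoid.mult = (\<lambda>(a, p) (b, q). (a \<otimes>\<^bsub>N\<^esub> \<phi> p b, p \<otimes>\<^bsub>Q\<^esub> q)),
      one = (\<one>\<^bsub>N\<^esub>, \<one>\<^bsub>Q\<^esub>)\<rparr>"

definition translate_coords :: "('k, 'n) monoid_scheme \<Rightarrow> 'k \<Rightarrow> ('k \<Rightarrow> 'h) \<Rightarrow> 'k \<Rightarrow> 'h" where
  "translate_coords K k f = (\<lambda>x\<in>carrier K. f (inv\<^bsub>K\<^esub> k \<otimes>\<^bsub>K\<^esub> x))"

definition wreath_product ::
    "('h, 'm) monoid_scheme \<Rightarrow> ('k, 'n) monoid_scheme \<Rightarrow> (('k \<Rightarrow> 'h) \<times> 'k) monoid" where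
  "wreath_product H K =
     semidirect_product (sum_group (carrier K) (\<lambda>_. H)) K (translate_coords K)"

(* Meaningful only for g in the submonoid generated by S; for a generating set closed under
   inverses this is the whole group. *)
definition word_length :: "('a, 'm) monoid_scheme \<Rightarrow> 'a set \<Rightarrow> 'a \<Rightarrow> nat" where
  "word_length G S g =
     (LEAST l. \<exists>ws. length ws = l \<and> set ws \<subseteq> S \<and> foldr (\<otimes>\<^bsub>G\<^esub>) ws \<one>\<^bsub>G\<^esub> = g)"

definition word_dist :: "('a, 'm) monoid_scheme \<Rightarrow> 'a set \<Rightarrow> 'a \<Rightarrow> 'a \<Rightarrow> nat" where
  "word_dist G S g h = word_length G S (inv\<^bsub>G\<^esub> g \<otimes>\<^bsub>G\<^esub> h)"

definition word_ball :: "('a, 'm) monoid_scheme \<Rightarrow> 'a set \<Rightarrow> nat \<Rightarrow> 'a \<Rightarrow> 'a set" where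
  "word_ball G S r g = {h \<in> carrier G. word_dist G S g h \<le> r}"

(* Convergence of subsets of the carrier in the Cantor topology, i.e. pointwise convergence of
   indicator functions. *)
definition subsets_converge ::
    "('a, 'm) monoid_scheme \<Rightarrow> (nat \<Rightarrow> 'a set) \<Rightarrow> 'a set \<Rightarrow> bool" where
  "subsets_converge G A P \<longleftrightarrow>
     (\<forall>g\<in>carrier G. \<forall>\<^sub>F i in sequentially. g \<in> A i \<longleftrightarrow> g \<in> P)"

definition horoball :: "('a, 'm) monoid_scheme \<Rightarrow> 'a set \<Rightarrow> 'a set \<Rightarrow> bool" where
  "horoball G S P \<longleftrightarrow>
     P \<subseteq> carrier G \<and> P \<noteq> {} \<and> P \<noteq> carrier G \<and>
     (\<exists>(g :: nat \<Rightarrow> 'a) (n :: nat \<Rightarrow> nat).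
        (\<forall>i. g i \<in> carrier G) \<and> filterlim n at_top sequentially \<and>
        subsets_converge G (\<lambda>i. word_ball G S (n i) (g i)) P)"

definition connected_wrt :: "('a, 'm) monoid_scheme \<Rightarrow> 'a set \<Rightarrow> 'a set \<Rightarrow> bool" where
  "connected_wrt G T A \<longleftrightarrow>
     (\<forall>g\<in>A. \<forall>g'\<in>A. \<exists>(k :: nat) (p :: nat \<Rightarrow> 'a).
        p 0 = g \<and> p k = g' \<and> (\<forall>i\<le>k. p i \<in> A) \<and> (\<forall>i<k. p (Suc i) \<in> p i <#\<^bsub>G\<^esub> T))"

lemma group_wreath_product:
  assumes "group H" and "group K"
  shows "group (wreath_product H K)"
proof -
  interpret H: group H by fact
  interpret K: group K by fact
  define N where "N = sum_group (carrier K) (\<lambda>_. H)"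
  interpret N: group N unfolding N_def using assms by simp
  have carN: "f \<in> carrier N \<longleftrightarrow>
      f \<in> carrier K \<rightarrow>\<^sub>E carrier H \<and> finite {x \<in> carrier K. f x \<noteq> \<one>\<^bsub>H\<^esub>}" for f
    unfolding N_def using assms by (simp add: carrier_sum_group)
  have multN: "f \<otimes>\<^bsub>N\<^esub> g = (\<lambda>x\<in>carrier K. f x \<otimes>\<^bsub>H\<^esub> g x)" for f g
    unfolding N_def by simp
  have tr_closed: "translate_coords K k f \<in> carrier N"
    if k: "k \<in> carrier K" and f: "f \<in> carrier N" for k f
  proof -
    have "{x \<in> carrier K. translate_coords K k f x \<noteq> \<one>\<^bsub>H\<^esub>}
        \<subseteq> (\<lambda>y. k \<otimes>\<^bsub>K\<^esub> y) ` {x \<in> carrier K. f x \<noteq> \<one>\<^bsub>H\<^esub>}"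
    proof
      fix x assume x: "x \<in> {x \<in> carrier K. translate_coords K k f x \<noteq> \<one>\<^bsub>H\<^esub>}"
      then have "x = k \<otimes>\<^bsub>K\<^esub> (inv\<^bsub>K\<^esub> k \<otimes>\<^bsub>K\<^esub> x)"
        using k by (simp add: K.m_assoc[symmetric])
      moreover have "inv\<^bsub>K\<^esub> k \<otimes>\<^bsub>K\<^esub> x \<in> {x \<in> carrier K. f x \<noteq> \<one>\<^bsub>H\<^esub>}"
        using x k by (auto simp: translate_coords_def)
      ultimately show "x \<in> (\<lambda>y. k \<otimes>\<^bsub>K\<^esub> y) ` {x \<in> carrier K. f x \<noteq> \<one>\<^bsub>H\<^esub>}"
        by (rule image_eqI)
    qed
    then have "finite {x \<in> carrier K. translate_coords K k f x \<noteq> \<one>\<^bsub>H\<^esub>}"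
      using f finite_surj carN by blast
    moreover have "translate_coords K k f \<in> carrier K \<rightarrow>\<^sub>E carrier H"
      using k f carN by (auto simp: translate_coords_def PiE_iff)
    ultimately show ?thesis using carN by blast
  qed
  have tr_mult: "translate_coords K k (f \<otimes>\<^bsub>N\<^esub> g)
      = translate_coords K k f \<otimes>\<^bsub>N\<^esub> translate_coords K k g" if "k \<in> carrier K" for k f g
    using that by (auto simp: multN translate_coords_def fun_eq_iff)
  have tr_comp: "translate_coords K (k \<otimes>\<^bsub>K\<^esub> l) f = translate_coords K k (translate_coords K l f)"
    if "k \<in> carrier K" "l \<in> carrier K" for k l f
    using that by (auto simp: translate_coords_def fun_eq_iff K.inv_mult_group K.m_assoc)
  have tr_one: "translate_coords K \<one>\<^bsub>K\<^esub> f = f" if "f \<in> carrier N" for f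
    using that carN by (auto simp: translate_coords_def fun_eq_iff PiE_iff extensional_def)
  have W: "wreath_product H K = semidirect_product N K (translate_coords K)"
    by (simp add: wreath_product_def N_def)
  show ?thesis unfolding W
  proof (rule groupI)
    fix x y z
    assume "x \<in> carrier (semidirect_product N K (translate_coords K))"
      "y \<in> carrier (semidirect_product N K (translate_coords K))"
      "z \<in> carrier (semidirect_product N K (translate_coords K))"
    then show "x \<otimes>\<^bsub>semidirect_product N K (translate_coords K)\<^esub> y
          \<otimes>\<^bsub>semidirect_product N K (translate_coords K)\<^esub> z
        = x \<otimes>\<^bsub>semidirect_product N K (translate_coords K)\<^esub>
          (y \<otimes>\<^bsub>semidirect_product N K (translate_coords K)\<^esub> z)"
      by (auto simp: semidirect_product_def tr_mult tr_comp tr_closed N.m_assoc K.m_assoc)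
  next
    fix x assume "x \<in> carrier (semidirect_product N K (translate_coords K))"
    then obtain f k where x: "x = (f, k)" "f \<in> carrier N" "k \<in> carrier K"
      by (auto simp: semidirect_product_def)
    let ?y = "(translate_coords K (inv\<^bsub>K\<^esub> k) (inv\<^bsub>N\<^esub> f), inv\<^bsub>K\<^esub> k)"
    have "translate_coords K (inv\<^bsub>K\<^esub> k) (inv\<^bsub>N\<^esub> f) \<otimes>\<^bsub>N\<^esub> translate_coords K (inv\<^bsub>K\<^esub> k) f
        = translate_coords K (inv\<^bsub>K\<^esub> k) \<one>\<^bsub>N\<^esub>"
      using x by (simp add: tr_mult[symmetric])
    also have "\<dots> = \<one>\<^bsub>N\<^esub>"
      using x by (auto simp: N_def translate_coords_def fun_eq_iff)
    finally show "\<exists>y\<in>carrier (semidirect_product N K (translate_coords K)).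
        y \<otimes>\<^bsub>semidirect_product N K (translate_coords K)\<^esub> x
          = \<one>\<^bsub>semidirect_product N K (translate_coords K)\<^esub>"
      using x tr_closed by (intro bexI[of _ ?y]) (auto simp: semidirect_product_def)
  qed (auto simp: semidirect_product_def tr_closed tr_one)
qed

end

theory Submission
  imports Defs "HOL-Library.Diagonal_Subsequence"
begin

text \<open>
  Take \<open>u, v \<in> K\<close> with \<open>|u| = |v| = m\<close> and \<open>d(u, v) = 2 m\<close>, and let \<open>g \<in> H \<wr> K\<close> have nontrivial lamps
  exactly at \<open>u\<close> and \<open>v\<close> and trivial cursor. A word for \<open>g z\<close> with \<open>z\<close> short must send the cursor
  close to both \<open>u\<close> and \<open>v\<close>, in one of the two orders, so
  \<open>|g z| \<ge> 3 m + min (d(u, k)) (d(v, k)) - O(1)\<close> where \<open>k\<close> is the cursor of \<open>z\<close>. This is sharp on the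
  geodesics from the origin to \<open>u\<close> and to \<open>v\<close>: writing \<open>g\<close> as a product of two commuting conjugates
  \<open>w x w\<^sup>-\<^sup>1\<close> of a single lamp, the last return journey can be cut short, in either order. Hence near
  the origin the ball of radius \<open>4 m - p + O(1)\<close> about \<open>g\<^sup>-\<^sup>1\<close> has a part with cursor within
  \<open>m - p + O(1)\<close> of \<open>u\<close> and a part with cursor within \<open>m - p + O(1)\<close> of \<open>v\<close>; for a large constant
  \<open>p\<close> no element of \<open>T\<close> leads from one to the other. A limit for \<open>m \<rightarrow> \<infinity>\<close> is a disconnected horoball.
\<close>

section \<open>Word length\<close>

lemma (in monoid) foldr_mult_closed:
  "set ws \<subseteq> carrier G \<Longrightarrow> foldr (\<otimes>) ws \<one> \<in> carrier G"
  by (induction ws) auto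

lemma (in monoid) foldr_mult_append:
  "set us \<subseteq> carrier G \<Longrightarrow> set ws \<subseteq> carrier G \<Longrightarrow>
    foldr (\<otimes>) (us @ ws) \<one> = foldr (\<otimes>) us \<one> \<otimes> foldr (\<otimes>) ws \<one>"
  by (induction us) (auto simp: m_assoc foldr_mult_closed simp del: foldr_append)

lemma (in group) conjugate_eq_one_iff:
  assumes "a \<in> carrier G" "b \<in> carrier G"
  shows "a \<otimes> b \<otimes> inv a = \<one> \<longleftrightarrow> b = \<one>"
proof
  assume "a \<otimes> b \<otimes> inv a = \<one>"
  then have "a \<otimes> b = a" using assms by (metis inv_closed inv_equality inv_inv m_closed)
  then show "b = \<one>" using assms by (metis l_cancel one_closed r_one)
qed (use assms in simp)

locale word_metric = group G for G (structure) +
  fixes S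
  assumes gen: "symmetric_generating_set G S"
begin

abbreviation len :: "'a \<Rightarrow> nat" where "len \<equiv> word_length G S"

lemma S_closed: "S \<subseteq> carrier G" and S_fin: "finite S" and S_one: "\<one> \<in> S"
  and S_gen: "generate G S = carrier G" and S_inv: "s \<in> S \<Longrightarrow> inv s \<in> S"
  using gen unfolding symmetric_generating_set_def by auto

lemma ex_word:
  assumes "g \<in> carrier G"
  shows "\<exists>ws. set ws \<subseteq> S \<and> foldr (\<otimes>) ws \<one> = g"
proof -
  have "g \<in> generate G S" using assms S_gen by simp
  then show ?thesis
  proof (induction rule: generate.induct)
    case one
    show ?case by (intro exI[of _ "[]"]) auto
  next
    case (incl s)
    then show ?case using S_closed by (intro exI[of _ "[s]"]) auto
  next
    case (inv s)
    then show ?case using S_closed S_inv by (intro exI[of _ "[inv s]"]) auto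
  next
    case (eng g h)
    then obtain us ws where "set us \<subseteq> S" "foldr (\<otimes>) us \<one> = g" "set ws \<subseteq> S" "foldr (\<otimes>) ws \<one> = h"
      by blast
    then show ?case using S_closed
      by (intro exI[of _ "us @ ws"]) (auto simp: foldr_mult_append simp del: foldr_append)
  qed
qed

lemma len_word:
  assumes "g \<in> carrier G"
  obtains ws where "length ws = len g" "set ws \<subseteq> S" "foldr (\<otimes>) ws \<one> = g"
proof -
  have "\<exists>ws. length ws = len g \<and> set ws \<subseteq> S \<and> foldr (\<otimes>) ws \<one> = g"
    unfolding word_length_def by (rule LeastI_ex) (use ex_word[OF assms] in blast)
  then show ?thesis using that by blast
qed

lemma len_foldr_le:
  "set ws \<subseteq> S \<Longrightarrow> len (foldr (\<otimes>) ws \<one>) \<le> length ws"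
  unfolding word_length_def by (rule Least_le) blast

lemma len_one [simp]: "len \<one> = 0"
  using len_foldr_le[of "[]"] by simp

lemma len_0D:
  assumes "g \<in> carrier G" "len g = 0"
  shows "g = \<one>"
proof -
  obtain ws where "length ws = len g" "foldr (\<otimes>) ws \<one> = g"
    using len_word assms(1) by blast
  then show ?thesis using assms(2) by simp
qed

lemma len_gen: "s \<in> S \<Longrightarrow> len s \<le> 1"
  using len_foldr_le[of "[s]"] S_closed by auto

lemma len_le_1D:
  assumes "g \<in> carrier G" "len g \<le> 1"
  shows "g \<in> S"
proof -
  obtain ws where ws: "length ws = len g" "set ws \<subseteq> S" "foldr (\<otimes>) ws \<one> = g"
    using len_word assms(1) by blast
  have "length ws \<le> 1" using ws(1) assms(2) by simp
  then consider "ws = []" | s where "ws = [s]" by (cases ws) auto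
  then show ?thesis
  proof cases
    case 1
    then show ?thesis using ws(3) S_one by simp
  next
    case (2 s)
    then have "s \<in> S" "s \<otimes> \<one> = g" using ws(2,3) by auto
    then show ?thesis using S_closed by auto
  qed
qed

lemma len_mult:
  assumes "g \<in> carrier G" "h \<in> carrier G"
  shows "len (g \<otimes> h) \<le> len g + len h"
proof -
  obtain us where us: "length us = len g" "set us \<subseteq> S" "foldr (\<otimes>) us \<one> = g"
    using len_word assms(1) by blast
  obtain ws where ws: "length ws = len h" "set ws \<subseteq> S" "foldr (\<otimes>) ws \<one> = h"
    using len_word assms(2) by blast
  have "len (foldr (\<otimes>) (us @ ws) \<one>) \<le> length (us @ ws)"
    using us(2) ws(2) by (intro len_foldr_le) simp
  moreover have "foldr (\<otimes>) (us @ ws) \<one> = g \<otimes> h"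
    using foldr_mult_append[of us ws] us ws S_closed by (metis subset_trans)
  ultimately show ?thesis using us(1) ws(1) by (metis length_append)
qed

text \<open>Cut a shortest word after \<open>i\<close> letters. The bounds are inequalities because
  the word may have fewer than \<open>i\<close> letters.\<close>

lemma len_split:
  assumes "g \<in> carrier G" "len g \<le> i + j"
  obtains a b where "a \<in> carrier G" "b \<in> carrier G" "g = a \<otimes> b" "len a \<le> i" "len b \<le> j"
proof -
  obtain ws where ws: "length ws = len g" "set ws \<subseteq> S" "foldr (\<otimes>) ws \<one> = g"
    using len_word assms(1) by blast
  let ?a = "foldr (\<otimes>) (take i ws) \<one>" and ?b = "foldr (\<otimes>) (drop i ws) \<one>"
  have sub: "set (take i ws) \<subseteq> S" "set (drop i ws) \<subseteq> S"
    using ws(2) set_take_subset[of i ws] set_drop_subset[of i ws] by auto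
  then have cl: "set (take i ws) \<subseteq> carrier G" "set (drop i ws) \<subseteq> carrier G"
    using S_closed by blast+
  have "g = ?a \<otimes> ?b"
    using foldr_mult_append[OF cl] ws(3) by (metis append_take_drop_id)
  moreover have "len ?a \<le> i" "len ?b \<le> j"
    using len_foldr_le[OF sub(1)] len_foldr_le[OF sub(2)] ws(1) assms(2) by auto
  ultimately show ?thesis
    using that foldr_mult_closed[OF cl(1)] foldr_mult_closed[OF cl(2)] by blast
qed

lemma len_Suc_split:
  assumes "g \<in> carrier G" "len g \<le> Suc n"
  obtains s h where "s \<in> S" "h \<in> carrier G" "g = s \<otimes> h" "len h \<le> n"
proof -
  have "len g \<le> 1 + n" using assms(2) by simp
  then obtain s h where "s \<in> carrier G" "h \<in> carrier G" "g = s \<otimes> h" "len s \<le> 1" "len h \<le> n"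
    using len_split assms(1) by blast
  then show ?thesis using that len_le_1D by blast
qed

lemma len_inv_le:
  assumes "g \<in> carrier G"
  shows "len (inv g) \<le> len g"
proof -
  have "len (inv g) \<le> n" if "g \<in> carrier G" "len g \<le> n" for g n
    using that
  proof (induction n arbitrary: g)
    case 0
    then have "g = \<one>" using len_0D by simp
    then show ?case by simp
  next
    case (Suc n)
    obtain s h where sh: "s \<in> S" "h \<in> carrier G" "g = s \<otimes> h" "len h \<le> n"
      using len_Suc_split[OF Suc.prems] by blast
    have "s \<in> carrier G" using sh(1) S_closed by blast
    then have "len (inv g) \<le> len (inv h) + len (inv s)"
      using sh(2,3) len_mult by (simp add: inv_mult_group)
    moreover have "len (inv s) \<le> 1" using len_gen S_inv sh(1) by blast
    ultimately show ?case using Suc.IH[OF sh(2,4)] by linarith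
  qed
  then show ?thesis using assms by blast
qed

lemma len_inv: "g \<in> carrier G \<Longrightarrow> len (inv g) = len g"
  using len_inv_le[of g] len_inv_le[of "inv g"] by simp

text \<open>Multiplying the conjugate by \<open>a\<close> cancels the end of the return journey
  \<open>inv (a \<otimes> b)\<close> and leaves only \<open>inv b\<close>. This saving is what later
  puts short elements into balls with a distant centre.\<close>

lemma len_conjugate_prefix:
  assumes "a \<in> carrier G" "b \<in> carrier G" "x \<in> carrier G"
  shows "len ((a \<otimes> b) \<otimes> x \<otimes> inv (a \<otimes> b) \<otimes> a) \<le> len (a \<otimes> b) + len x + len b"
proof -
  have "inv (a \<otimes> b) \<otimes> a = inv b" using assms by (simp add: inv_mult_group m_assoc)
  then have eq: "(a \<otimes> b) \<otimes> x \<otimes> inv (a \<otimes> b) \<otimes> a = (a \<otimes> b) \<otimes> x \<otimes> inv b"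
    using assms by (simp add: m_assoc[of "(a \<otimes> b) \<otimes> x"])
  have "len ((a \<otimes> b) \<otimes> x \<otimes> inv b) \<le> len ((a \<otimes> b) \<otimes> x) + len b"
    using len_mult[of "(a \<otimes> b) \<otimes> x" "inv b"] len_inv[of b] assms by simp
  moreover have "len ((a \<otimes> b) \<otimes> x) \<le> len (a \<otimes> b) + len x"
    using len_mult[of "a \<otimes> b" x] assms by simp
  ultimately show ?thesis unfolding eq by linarith
qed

lemma len_conjugate:
  assumes "w \<in> carrier G" "x \<in> carrier G"
  shows "len (w \<otimes> x \<otimes> inv w) \<le> 2 * len w + len x"
  using len_conjugate_prefix[of \<one> w x] assms by simp

text \<open>Centres are written as inverses so that left invariance turns membership into the length
  of a product, the quantity that the estimates below control.\<close>

lemma mem_word_ball_inv: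
  assumes "g \<in> carrier G"
  shows "z \<in> word_ball G S n (inv g) \<longleftrightarrow> z \<in> carrier G \<and> len (g \<otimes> z) \<le> n"
  using assms by (auto simp: word_ball_def word_dist_def)

text \<open>Finiteness of balls serves twice: it makes the group countable, as the diagonal argument
  requires, and it gives a finite supply of endpoints for a pigeonhole argument.\<close>

lemma finite_len_le: "finite {g \<in> carrier G. len g \<le> n}"
proof (induction n)
  case 0
  have "{g \<in> carrier G. len g \<le> 0} \<subseteq> {\<one>}" using len_0D by auto
  then show ?case using finite_subset by blast
next
  case (Suc n)
  have "{g \<in> carrier G. len g \<le> Suc n} \<subseteq> (\<lambda>(a, b). a \<otimes> b) ` (S \<times> {g \<in> carrier G. len g \<le> n})"
  proof
    fix g assume "g \<in> {g \<in> carrier G. len g \<le> Suc n}"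
    then obtain s h where "s \<in> S" "h \<in> carrier G" "g = s \<otimes> h" "len h \<le> n"
      using len_Suc_split[of g n] by blast
    then show "g \<in> (\<lambda>(a, b). a \<otimes> b) ` (S \<times> {g \<in> carrier G. len g \<le> n})"
      by (intro image_eqI[of _ _ "(s, h)"]) auto
  qed
  then show ?case using Suc.IH S_fin by (meson finite_SigmaI finite_imageI finite_subset)
qed

lemma countable_carrier: "countable (carrier G)"
proof -
  have "carrier G = (\<Union>n. {g \<in> carrier G. len g \<le> n})" by auto
  moreover have "countable (\<Union>n. {g \<in> carrier G. len g \<le> n})"
    by (rule countable_UN) (simp_all add: countable_finite finite_len_le)
  ultimately show ?thesis by simp
qed

text \<open>A prefix of a shortest word is again shortest, and an infinite group with finite balls
  has words long enough to cut.\<close>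

lemma ex_len:
  assumes "infinite (carrier G)"
  obtains g where "g \<in> carrier G" "len g = n"
proof -
  have "\<not> carrier G \<subseteq> {g \<in> carrier G. len g \<le> n}"
    using assms finite_len_le finite_subset by blast
  then obtain y where y: "y \<in> carrier G" "\<not> len y \<le> n" by blast
  then obtain a b where ab: "a \<in> carrier G" "b \<in> carrier G" "y = a \<otimes> b" "len a \<le> n" "len b \<le> len y - n"
    using len_split[of y n "len y - n"] by auto
  then have "len a = n" using len_mult[OF ab(1,2)] y(2) by simp
  then show ?thesis using that ab by blast
qed

section \<open>The left-invariant word distance\<close>

abbreviation wdist :: "'a \<Rightarrow> 'a \<Rightarrow> nat" where "wdist \<equiv> word_dist G S"

lemma dist_one: "g \<in> carrier G \<Longrightarrow> wdist \<one> g = len g"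
  by (simp add: word_dist_def)

lemma dist_commute:
  assumes "g \<in> carrier G" "h \<in> carrier G"
  shows "wdist g h = wdist h g"
  using len_inv[of "inv g \<otimes> h"] assms by (simp add: word_dist_def inv_mult_group)

lemma dist_triangle:
  assumes "x \<in> carrier G" "y \<in> carrier G" "z \<in> carrier G"
  shows "wdist x z \<le> wdist x y + wdist y z"
proof -
  have "y \<otimes> (inv y \<otimes> z) = z" using assms by (simp add: m_assoc[symmetric])
  then have "inv x \<otimes> z = (inv x \<otimes> y) \<otimes> (inv y \<otimes> z)" using assms by (simp add: m_assoc)
  then show ?thesis using len_mult[of "inv x \<otimes> y" "inv y \<otimes> z"] assms by (simp add: word_dist_def)
qed

lemma dist_mult_right:
  "g \<in> carrier G \<Longrightarrow> h \<in> carrier G \<Longrightarrow> wdist g (g \<otimes> h) = len h"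
  by (simp add: word_dist_def m_assoc[symmetric])

lemma dist_mult_left:
  "g \<in> carrier G \<Longrightarrow> x \<in> carrier G \<Longrightarrow> y \<in> carrier G \<Longrightarrow> wdist (g \<otimes> x) y = wdist x (inv g \<otimes> y)"
  by (simp add: word_dist_def inv_mult_group m_assoc)

end

section \<open>Disconnected horoballs as limits\<close>

text \<open>Guarantees that a disconnected limit is a proper subset. The prefixes of a
  \<open>T\<close>-word for the quotient of two elements trace the path between them.\<close>

lemma connected_wrt_carrier:
  assumes "group G" "symmetric_generating_set G T"
  shows "connected_wrt G T (carrier G)"
proof -
  interpret word_metric G T using assms by (simp add: word_metric_def word_metric_axioms_def)
  have path: "\<exists>k p. p 0 = g \<and> p k = g \<otimes>\<^bsub>G\<^esub> foldr (\<otimes>\<^bsub>G\<^esub>) ws \<one>\<^bsub>G\<^esub> \<and> (\<forall>i\<le>k. p i \<in> carrier G) \<and>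
      (\<forall>i<k. p (Suc i) \<in> p i <#\<^bsub>G\<^esub> T)"
    if "set ws \<subseteq> T" "g \<in> carrier G" for g ws
    using that
  proof (induction ws arbitrary: g)
    case Nil
    then show ?case by (intro exI[of _ 0] exI[of _ "\<lambda>_. g"]) auto
  next
    case (Cons s ws)
    have s: "s \<in> T" "s \<in> carrier G" "set ws \<subseteq> T" using Cons.prems S_closed by auto
    then obtain k p where p: "p 0 = g \<otimes>\<^bsub>G\<^esub> s" "p k = g \<otimes>\<^bsub>G\<^esub> s \<otimes>\<^bsub>G\<^esub> foldr (\<otimes>\<^bsub>G\<^esub>) ws \<one>\<^bsub>G\<^esub>"
      "\<forall>i\<le>k. p i \<in> carrier G" "\<forall>i<k. p (Suc i) \<in> p i <#\<^bsub>G\<^esub> T"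
      using Cons.IH[of "g \<otimes>\<^bsub>G\<^esub> s"] Cons.prems by auto
    have cl: "foldr (\<otimes>\<^bsub>G\<^esub>) ws \<one>\<^bsub>G\<^esub> \<in> carrier G" using s S_closed foldr_mult_closed by blast
    define p' where "p' = (\<lambda>i. case i of 0 \<Rightarrow> g | Suc j \<Rightarrow> p j)"
    have "p' 0 = g" "p' (Suc k) = g \<otimes>\<^bsub>G\<^esub> foldr (\<otimes>\<^bsub>G\<^esub>) (s # ws) \<one>\<^bsub>G\<^esub>"
      using p s cl Cons.prems by (auto simp: p'_def m_assoc)
    moreover have "\<forall>i\<le>Suc k. p' i \<in> carrier G"
      using p Cons.prems by (auto simp: p'_def split: nat.split)
    moreover have "\<forall>i<Suc k. p' (Suc i) \<in> p' i <#\<^bsub>G\<^esub> T"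
      using p s by (auto simp: p'_def l_coset_def split: nat.split)
    ultimately show ?case by blast
  qed
  show ?thesis unfolding connected_wrt_def
  proof (intro ballI)
    fix g g' assume g: "g \<in> carrier G" "g' \<in> carrier G"
    obtain ws where ws: "set ws \<subseteq> T" "foldr (\<otimes>\<^bsub>G\<^esub>) ws \<one>\<^bsub>G\<^esub> = inv\<^bsub>G\<^esub> g \<otimes>\<^bsub>G\<^esub> g'"
      using ex_word[of "inv\<^bsub>G\<^esub> g \<otimes>\<^bsub>G\<^esub> g'"] g by auto
    have "g \<otimes>\<^bsub>G\<^esub> (inv\<^bsub>G\<^esub> g \<otimes>\<^bsub>G\<^esub> g') = g'" using g by (simp add: m_assoc[symmetric])
    then show "\<exists>k p. p 0 = g \<and> p k = g' \<and> (\<forall>i\<le>k. p i \<in> carrier G) \<and>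
        (\<forall>i<k. p (Suc i) \<in> p i <#\<^bsub>G\<^esub> T)"
      using path[OF ws(1) g(1)] ws(2) by simp
  qed
qed

text \<open>Sequential compactness of the Cantor space of subsets of \<open>C\<close>, by diagonal
  extraction over the points of \<open>C\<close>.\<close>

lemma sets_convergent_subsequence:
  fixes A :: "nat \<Rightarrow> 'a set"
  assumes "countable C"
  obtains r P where "strict_mono r" "P \<subseteq> C"
    "\<And>x. x \<in> C \<Longrightarrow> \<forall>\<^sub>F i in sequentially. x \<in> A (r i) \<longleftrightarrow> x \<in> P"
proof (cases "C = {}")
  case True
  then show ?thesis using that[of id "{}"] by (simp add: strict_mono_def)
next
  case False
  define e where "e = from_nat_into C"
  \<comment> \<open>Along \<open>s\<close>, membership of the \<open>n\<close>-th point is constant.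
    Subsequences inherit this, as the diagonal construction demands.\<close>
  define Q where "Q = (\<lambda>n (s :: nat \<Rightarrow> nat). (\<forall>i. e n \<in> A (s i)) \<or> (\<forall>i. e n \<notin> A (s i)))"
  have ex: "\<exists>r'. strict_mono r' \<and> Q n (s \<circ> r')" for n and s :: "nat \<Rightarrow> nat"
  proof -
    have "infinite ({i. e n \<in> A (s i)} \<union> {i. e n \<notin> A (s i)})"
      by (simp add: Un_def)
    then consider "infinite {i. e n \<in> A (s i)}" | "infinite {i. e n \<notin> A (s i)}"
      by blast
    then show ?thesis
    proof cases
      case 1
      then show ?thesis
        using strict_mono_enumerate[OF 1] enumerate_in_set[OF 1]
        by (intro exI[of _ "enumerate {i. e n \<in> A (s i)}"]) (auto simp: Q_def)
    next
      case 2
      then show ?thesis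
        using strict_mono_enumerate[OF 2] enumerate_in_set[OF 2]
        by (intro exI[of _ "enumerate {i. e n \<notin> A (s i)}"]) (auto simp: Q_def)
    qed
  qed
  interpret subseqs Q by standard (rule ex)
  \<comment> \<open>Beyond index \<open>k\<close> the diagonal sequence runs through a refinement
    along which the \<open>k\<close>-th point is already decided.\<close>
  have Q: "Q k (diagseq \<circ> (+) (Suc k))" for k
    by (rule diagseq_holds) (auto simp: Q_def)
  define P where "P = {x \<in> C. \<forall>\<^sub>F i in sequentially. x \<in> A (diagseq i)}"
  have "\<forall>\<^sub>F i in sequentially. x \<in> A (diagseq i) \<longleftrightarrow> x \<in> P" if x: "x \<in> C" for x
  proof -
    obtain k where k: "e k = x"
      using x False from_nat_into_surj[OF assms] unfolding e_def by blast
    consider "\<forall>i. x \<in> A (diagseq (Suc k + i))" | "\<forall>i. x \<notin> A (diagseq (Suc k + i))"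
      using Q[of k] unfolding Q_def k by auto
    then show ?thesis
    proof cases
      case 1
      then have ev: "\<forall>\<^sub>F i in sequentially. x \<in> A (diagseq i)"
        unfolding eventually_sequentially by (metis le_Suc_ex)
      then have "x \<in> P" using x by (simp add: P_def)
      then show ?thesis using ev by simp
    next
      case 2
      then have ev: "\<forall>\<^sub>F i in sequentially. x \<notin> A (diagseq i)"
        unfolding eventually_sequentially by (metis le_Suc_ex)
      have "x \<notin> P"
      proof
        assume "x \<in> P"
        then have "\<forall>\<^sub>F i in sequentially. x \<in> A (diagseq i)" by (simp add: P_def)
        with ev have "\<forall>\<^sub>F i :: nat in sequentially. False" by eventually_elim simp
        then show False by simp
      qed
      then show ?thesis using ev by simp
    qed
  qed
  then show ?thesis using that[OF subseq_diagseq, of P] by (auto simp: P_def)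
qed

text \<open>Pigeonhole: if every candidate failed at some stage, all would fail at the largest of
  these stages, because failure persists.\<close>

lemma finite_uniform_witness:
  fixes Q :: "nat \<Rightarrow> 'a \<Rightarrow> bool"
  assumes "finite F" and ex: "\<And>R. \<exists>x\<in>F. Q R x" and mono: "\<And>R R' x. R \<le> R' \<Longrightarrow> Q R' x \<Longrightarrow> Q R x"
  shows "\<exists>x\<in>F. \<forall>R. Q R x"
proof (rule ccontr)
  assume "\<not> ?thesis"
  then obtain N where N: "\<And>x. x \<in> F \<Longrightarrow> \<not> Q (N x) x" by metis
  obtain x where x: "x \<in> F" "Q (Max (N ` F)) x" using ex by blast
  then have "N x \<le> Max (N ` F)" using assms(1) by simp
  then show False using mono x N by blast
qed

text \<open>A ball may still join two points by a long detour, so only joins of at most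
  \<open>R\<close> steps are excluded. With \<open>R\<close> growing along the sequence, every
  finite path is excluded in the limit.\<close>

definition joined_within :: "('a, 'm) monoid_scheme \<Rightarrow> 'a set \<Rightarrow> 'a set \<Rightarrow> nat \<Rightarrow> 'a \<Rightarrow> 'a \<Rightarrow> bool" where
  "joined_within G T A R a b \<longleftrightarrow>
     (\<exists>k\<le>R. \<exists>p. p 0 = a \<and> p k = b \<and> (\<forall>i\<le>k. p i \<in> A) \<and> (\<forall>i<k. p (Suc i) \<in> p i <#\<^bsub>G\<^esub> T))"

lemma joined_within_mono:
  assumes "joined_within G T A R a b" "R \<le> R'"
  shows "joined_within G T A R' a b"
proof -
  obtain k p where "k \<le> R" "p 0 = a" "p k = b" "\<forall>i\<le>k. p i \<in> A" "\<forall>i<k. p (Suc i) \<in> p i <#\<^bsub>G\<^esub> T"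
    using assms(1) unfolding joined_within_def by blast
  moreover from this have "k \<le> R'" using assms(2) by simp
  ultimately show ?thesis unfolding joined_within_def by blast
qed

text \<open>Since \<open>F\<close> does not depend on \<open>R\<close>, one pair of endpoints serves
  all \<open>R\<close> and survives in a limit of the balls. A path joining the pair in the limit is
  finite, so it lies in all late balls, which forbid paths that short.\<close>

lemma (in word_metric) disconnected_horoball_limit:
  assumes T: "symmetric_generating_set G T" and F: "finite F"
    and balls: "\<And>R. \<exists>c\<in>carrier G. \<exists>n\<ge>R. \<exists>a\<in>F. \<exists>b\<in>F. a \<in> word_ball G S n c \<and> b \<in> word_ball G S n c \<and>
      \<not> joined_within G T (word_ball G S n c) R a b"
  shows "\<exists>P. horoball G S P \<and> \<not> connected_wrt G T P"
proof -
  define Q where "Q = (\<lambda>R (a, b). \<exists>c\<in>carrier G. \<exists>n\<ge>R. a \<in> word_ball G S n c \<and> b \<in> word_ball G S n c \<and>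
      \<not> joined_within G T (word_ball G S n c) R a b)"
  have "\<exists>x\<in>F \<times> F. Q R x" for R using balls[of R] unfolding Q_def by fast
  moreover have "Q R x" if le: "R \<le> R'" and Q: "Q R' x" for R R' x
  proof -
    obtain a b where x: "x = (a, b)" by force
    obtain c n where cn: "c \<in> carrier G" "R' \<le> n" "a \<in> word_ball G S n c" "b \<in> word_ball G S n c"
      "\<not> joined_within G T (word_ball G S n c) R' a b"
      using Q unfolding Q_def x by blast
    then have "\<not> joined_within G T (word_ball G S n c) R a b"
      using joined_within_mono[of G T "word_ball G S n c" R a b, OF _ le] by blast
    moreover have "R \<le> n" using cn(2) le by simp
    ultimately show ?thesis using cn unfolding Q_def x by blast
  qed
  ultimately obtain x where "\<forall>R. Q R x" using finite_uniform_witness[of "F \<times> F" Q] F by blast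
  then obtain a b where "\<forall>R. Q R (a, b)" by (cases x) auto
  then have "\<forall>R. \<exists>c n. c \<in> carrier G \<and> R \<le> n \<and> a \<in> word_ball G S n c \<and> b \<in> word_ball G S n c \<and>
      \<not> joined_within G T (word_ball G S n c) R a b" unfolding Q_def by blast
  then obtain c n where c: "\<And>i. c i \<in> carrier G" and n: "\<And>i. i \<le> n i"
    and a: "\<And>i. a \<in> word_ball G S (n i) (c i)" and b: "\<And>i. b \<in> word_ball G S (n i) (c i)"
    and nj: "\<And>i. \<not> joined_within G T (word_ball G S (n i) (c i)) i a b"
    by metis
  obtain r P where r: "strict_mono r" and P: "P \<subseteq> carrier G"
    and lim: "\<And>x. x \<in> carrier G \<Longrightarrow>
      \<forall>\<^sub>F i in sequentially. x \<in> word_ball G S (n (r i)) (c (r i)) \<longleftrightarrow> x \<in> P"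
    using sets_convergent_subsequence[OF countable_carrier, of "\<lambda>i. word_ball G S (n i) (c i)"] by blast
  have ri: "i \<le> r i" for i using r by (rule strict_mono_imp_increasing)
  have inP: "x \<in> P" if "\<And>i. x \<in> word_ball G S (n i) (c i)" for x
  proof -
    have "x \<in> carrier G" using that[of 0] by (simp add: word_ball_def)
    from lim[OF this] have "\<forall>\<^sub>F i :: nat in sequentially. x \<in> P" by eventually_elim (use that in blast)
    then show ?thesis by simp
  qed
  have aP: "a \<in> P" and bP: "b \<in> P" using inP a b by blast+
  have disc: "\<not> connected_wrt G T P"
  proof
    assume "connected_wrt G T P"
    then obtain k p where p: "p 0 = a" "p k = b" "\<forall>i\<le>k. p i \<in> P" "\<forall>i<k. p (Suc i) \<in> p i <# T"
      unfolding connected_wrt_def using aP bP by blast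
    have "\<forall>\<^sub>F i in sequentially. \<forall>j\<in>{..k}. p j \<in> word_ball G S (n (r i)) (c (r i)) \<longleftrightarrow> p j \<in> P"
    proof (rule eventually_ball_finite)
      show "\<forall>j\<in>{..k}. \<forall>\<^sub>F i in sequentially.
          p j \<in> word_ball G S (n (r i)) (c (r i)) \<longleftrightarrow> p j \<in> P"
      proof
        fix j assume "j \<in> {..k}"
        then have "p j \<in> carrier G" using p(3) P by blast
        then show "\<forall>\<^sub>F i in sequentially. p j \<in> word_ball G S (n (r i)) (c (r i)) \<longleftrightarrow> p j \<in> P"
          by (rule lim)
      qed
    qed simp
    then obtain N where N: "\<And>i j. N \<le> i \<Longrightarrow> j \<le> k \<Longrightarrow> p j \<in> word_ball G S (n (r i)) (c (r i))"
      using p(3) unfolding eventually_sequentially by auto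
    \<comment> \<open>The index \<open>max N k\<close> is late enough for its ball to contain the
      whole path and for its forbidden number of steps to reach \<open>k\<close>.\<close>
    have "k \<le> r (max N k)" using ri[of "max N k"] by simp
    then have "joined_within G T (word_ball G S (n (r (max N k))) (c (r (max N k)))) (r (max N k)) a b"
      unfolding joined_within_def using p N[of "max N k"] by (intro exI[of _ k] conjI exI[of _ p]) auto
    then show False using nj by blast
  qed
  have "P \<noteq> carrier G" using disc connected_wrt_carrier[OF is_group T] by metis
  moreover have "filterlim (\<lambda>i. n (r i)) at_top sequentially"
  proof (rule filterlim_at_top_mono[OF filterlim_ident])
    show "\<forall>\<^sub>F i in sequentially. i \<le> n (r i)" using order_trans[OF ri n] by simp
  qed
  ultimately have "horoball G S P"
    unfolding horoball_def subsets_converge_def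
    using P aP c lim by (intro conjI exI[of _ "\<lambda>i. c (r i)"] exI[of _ "\<lambda>i. n (r i)"]) auto
  then show ?thesis using disc by blast
qed

section \<open>Wreath products\<close>

locale wreath_metric = H: group H + K: group K + W: word_metric "wreath_product H K" S
  for H :: "('h, 'm) monoid_scheme" and K :: "('k, 'n) monoid_scheme" and S
begin

abbreviation W where "W \<equiv> wreath_product H K"

lemma carrier_W:
  "g \<in> carrier W \<longleftrightarrow> fst g \<in> carrier K \<rightarrow>\<^sub>E carrier H \<and>
     finite {x \<in> carrier K. fst g x \<noteq> \<one>\<^bsub>H\<^esub>} \<and> snd g \<in> carrier K"
  using H.is_group by (cases g) (simp add: wreath_product_def semidirect_product_def carrier_sum_group)

lemma fst_closed [simp]: "g \<in> carrier W \<Longrightarrow> x \<in> carrier K \<Longrightarrow> fst g x \<in> carrier H"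
  and snd_closed [simp]: "g \<in> carrier W \<Longrightarrow> snd g \<in> carrier K"
  by (auto simp: carrier_W)

lemma fst_mult [simp]: "x \<in> carrier K \<Longrightarrow>
    fst (g \<otimes>\<^bsub>W\<^esub> h) x = fst g x \<otimes>\<^bsub>H\<^esub> fst h (inv\<^bsub>K\<^esub> (snd g) \<otimes>\<^bsub>K\<^esub> x)"
  and snd_mult [simp]: "snd (g \<otimes>\<^bsub>W\<^esub> h) = snd g \<otimes>\<^bsub>K\<^esub> snd h"
  and fst_one [simp]: "x \<in> carrier K \<Longrightarrow> fst \<one>\<^bsub>W\<^esub> x = \<one>\<^bsub>H\<^esub>"
  and snd_one [simp]: "snd \<one>\<^bsub>W\<^esub> = \<one>\<^bsub>K\<^esub>"
  by (auto simp: wreath_product_def semidirect_product_def translate_coords_def split: prod.split)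

lemma W_eqI:
  assumes "g \<in> carrier W" "h \<in> carrier W" "snd g = snd h"
    and "\<And>x. x \<in> carrier K \<Longrightarrow> fst g x = fst h x"
  shows "g = h"
proof -
  have "fst g = fst h" using assms by (intro PiE_ext[of _ "carrier K"]) (auto simp: carrier_W)
  then show ?thesis using assms(3) by (simp add: prod_eq_iff)
qed

section \<open>Projection to the cursor\<close>

lemma snd_hom: "group_hom W K snd"
  by unfold_locales (auto simp: hom_def)

lemma snd_inv [simp]: "g \<in> carrier W \<Longrightarrow> snd (inv\<^bsub>W\<^esub> g) = inv\<^bsub>K\<^esub> (snd g)"
  using group_hom.hom_inv[OF snd_hom] by blast

lemma snd_image_carrier: "snd ` carrier W = carrier K"
proof
  show "carrier K \<subseteq> snd ` carrier W"
  proof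
    fix k assume "k \<in> carrier K"
    then have "((\<lambda>x\<in>carrier K. \<one>\<^bsub>H\<^esub>), k) \<in> carrier W" by (auto simp: carrier_W)
    then show "k \<in> snd ` carrier W" by force
  qed
qed (simp add: image_subset_iff)

lemma symmetric_generating_set_snd:
  assumes "symmetric_generating_set W U"
  shows "symmetric_generating_set K (snd ` U)"
proof -
  have U: "finite U" "U \<subseteq> carrier W" "U = m_inv W ` U" "\<one>\<^bsub>W\<^esub> \<in> U" "generate W U = carrier W"
    using assms unfolding symmetric_generating_set_def by auto
  have "snd ` U = snd ` (m_inv W ` U)" using U(3) by simp
  also have "\<dots> = m_inv K ` (snd ` U)" using U(2) by (auto simp only: image_image snd_inv subset_iff intro!: image_cong)
  finally have "snd ` U = m_inv K ` (snd ` U)" .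
  moreover have "\<one>\<^bsub>K\<^esub> \<in> snd ` U" using U(4) snd_one by (metis image_eqI)
  moreover have "generate K (snd ` U) = carrier K"
    using group_hom.generate_img[OF snd_hom U(2)] U(5) snd_image_carrier by simp
  moreover have "snd ` U \<subseteq> carrier K" using U(2) snd_closed by (meson image_subsetI subsetD)
  ultimately show ?thesis
    unfolding symmetric_generating_set_def using U(1) by blast
qed

text \<open>With the projected generators as metric on \<open>K\<close>, one letter moves the cursor
  by at most one, so no comparison constants arise.\<close>

sublocale Q: word_metric K "snd ` S"
  by unfold_locales (rule symmetric_generating_set_snd[OF W.gen])

lemma len_snd_le:
  assumes "g \<in> carrier W"
  shows "Q.len (snd g) \<le> W.len g"
proof -
  have "Q.len (snd g) \<le> n" if "g \<in> carrier W" "W.len g \<le> n" for g n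
    using that
  proof (induction n arbitrary: g)
    case 0
    then have "g = \<one>\<^bsub>W\<^esub>" using W.len_0D by simp
    then show ?case using "0" by simp
  next
    case (Suc n)
    obtain s h where sh: "s \<in> S" "h \<in> carrier W" "g = s \<otimes>\<^bsub>W\<^esub> h" "W.len h \<le> n"
      using W.len_Suc_split[OF Suc.prems] by blast
    have "s \<in> carrier W" using sh(1) W.S_closed by blast
    then have "Q.len (snd g) \<le> Q.len (snd s) + Q.len (snd h)" using sh(2,3) Q.len_mult by simp
    moreover have "Q.len (snd s) \<le> 1" using sh(1) Q.len_gen by blast
    ultimately show ?case using Suc.IH[OF sh(2,4)] by linarith
  qed
  then show ?thesis using assms by blast
qed

text \<open>Lift letter by letter. The lamps of the lift are uncontrolled, which does no harm since
  lifts are only used for conjugation.\<close>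

lemma lift_len:
  assumes "k \<in> carrier K" "Q.len k \<le> n"
  obtains g where "g \<in> carrier W" "snd g = k" "W.len g \<le> n"
proof -
  have "\<exists>g\<in>carrier W. snd g = k \<and> W.len g \<le> n"
    using assms
  proof (induction n arbitrary: k)
    case 0
    then have "k = \<one>\<^bsub>K\<^esub>" using Q.len_0D by auto
    then show ?case by (intro bexI[of _ "\<one>\<^bsub>W\<^esub>"]) auto
  next
    case (Suc n)
    obtain a b where ab: "a \<in> snd ` S" "b \<in> carrier K" "k = a \<otimes>\<^bsub>K\<^esub> b" "Q.len b \<le> n"
      using Q.len_Suc_split[OF Suc.prems] by blast
    obtain h where h: "h \<in> carrier W" "snd h = b" "W.len h \<le> n" using Suc.IH[OF ab(2,4)] by blast
    obtain s where s: "s \<in> S" "snd s = a" using ab(1) by blast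
    have "s \<in> carrier W" using s W.S_closed by blast
    moreover have "W.len (s \<otimes>\<^bsub>W\<^esub> h) \<le> Suc n"
      using W.len_mult[of s h] W.len_gen[of s] s h \<open>s \<in> carrier W\<close> by simp
    ultimately show ?case using s h ab by (intro bexI[of _ "s \<otimes>\<^bsub>W\<^esub> h"]) auto
  qed
  then show ?thesis using that by blast
qed

section \<open>Lit lamps force visits of the cursor\<close>

definition reach :: "nat \<Rightarrow> bool" where
  "reach r \<longleftrightarrow> (\<forall>s\<in>S. \<forall>x\<in>carrier K. fst s x \<noteq> \<one>\<^bsub>H\<^esub> \<longrightarrow> Q.len x \<le> r)"

text \<open>Each of the finitely many generators alters finitely many lamps; \<open>r\<close> bounds
  their distance from the current cursor.\<close>

lemma ex_reach: "\<exists>r. reach r"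
proof -
  define D where "D = (\<Union>s\<in>S. {x \<in> carrier K. fst s x \<noteq> \<one>\<^bsub>H\<^esub>})"
  have "finite D" unfolding D_def using W.S_fin W.S_closed carrier_W by blast
  then have "Q.len x \<le> Max (Q.len ` D)" if "x \<in> D" for x using that by simp
  then have "reach (Max (Q.len ` D))" unfolding reach_def D_def by blast
  then show ?thesis by blast
qed

text \<open>Some letter must act on lamp \<open>v\<close>, and it can do so only while the cursor is
  within \<open>r\<close> of \<open>v\<close>; \<open>a\<close> is the prefix before that letter.
  The two lengths together stay within the budget \<open>n\<close>, so cutting there costs
  nothing.\<close>

lemma lit_visit:
  assumes "reach r" "g \<in> carrier W" "W.len g \<le> n" "v \<in> carrier K" "fst g v \<noteq> \<one>\<^bsub>H\<^esub>"
  shows "\<exists>a\<in>carrier W. \<exists>b\<in>carrier W. g = a \<otimes>\<^bsub>W\<^esub> b \<and> W.len a + W.len b \<le> n \<and> Q.wdist (snd a) v \<le> r"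
  using assms(2-)
proof (induction n arbitrary: g v)
  case 0
  then have "g = \<one>\<^bsub>W\<^esub>" using W.len_0D by simp
  then show ?case using "0" by simp
next
  case (Suc n)
  obtain s h where s: "s \<in> S" and h: "h \<in> carrier W" "g = s \<otimes>\<^bsub>W\<^esub> h" "W.len h \<le> n"
    using W.len_Suc_split[OF Suc.prems(1,2)] by blast
  have sh: "s \<in> carrier W" "h \<in> carrier W" "g = s \<otimes>\<^bsub>W\<^esub> h" "W.len h \<le> n"
    using s h W.S_closed by auto
  show ?case
  proof (cases "fst s v = \<one>\<^bsub>H\<^esub>")
    case False
    then have "Q.len v \<le> r" using assms(1) s Suc.prems(3) unfolding reach_def by blast
    then show ?thesis using Suc.prems
      by (intro bexI[of _ "\<one>\<^bsub>W\<^esub>"] bexI[of _ g]) (auto simp: Q.dist_one)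
  next
    case True
    \<comment> \<open>Seen from the cursor after \<open>s\<close>, the lamp \<open>v\<close> has
      coordinate \<open>?v\<close>, and the remainder \<open>h\<close> has to light it.\<close>
    let ?v = "inv\<^bsub>K\<^esub> (snd s) \<otimes>\<^bsub>K\<^esub> v"
    have v: "?v \<in> carrier K" using sh Suc.prems by simp
    have "fst h ?v \<noteq> \<one>\<^bsub>H\<^esub>" using Suc.prems sh True by auto
    then obtain a b where ab: "a \<in> carrier W" "b \<in> carrier W" "h = a \<otimes>\<^bsub>W\<^esub> b" "W.len a + W.len b \<le> n"
      "Q.wdist (snd a) ?v \<le> r" using Suc.IH[OF sh(2,4) v] by blast
    have "g = (s \<otimes>\<^bsub>W\<^esub> a) \<otimes>\<^bsub>W\<^esub> b" using sh ab by (simp add: W.m_assoc)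
    moreover have "W.len (s \<otimes>\<^bsub>W\<^esub> a) + W.len b \<le> Suc n"
      using W.len_mult[OF sh(1) ab(1)] W.len_gen[OF s] ab(4) by linarith
    moreover have "Q.wdist (snd (s \<otimes>\<^bsub>W\<^esub> a)) v \<le> r" using ab sh Suc.prems by (simp add: Q.dist_mult_left)
    ultimately show ?thesis using sh ab by (intro bexI[of _ "s \<otimes>\<^bsub>W\<^esub> a"] bexI[of _ b]) auto
  qed
qed

lemma lit_len_ge:
  assumes r: "reach r" and g: "g \<in> carrier W" and v: "v \<in> carrier K" "fst g v \<noteq> \<one>\<^bsub>H\<^esub>"
  shows "Q.len v \<le> W.len g + r"
proof -
  obtain a b where ab: "a \<in> carrier W" "b \<in> carrier W" "g = a \<otimes>\<^bsub>W\<^esub> b" "W.len a + W.len b \<le> W.len g"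
    "Q.wdist (snd a) v \<le> r" using lit_visit[OF r g order_refl v] by blast
  have "Q.len v \<le> Q.len (snd a) + Q.wdist (snd a) v"
    using Q.dist_triangle[of "\<one>\<^bsub>K\<^esub>" "snd a" v] ab v by (simp add: Q.dist_one)
  then show ?thesis using ab len_snd_le[of a] by linarith
qed

text \<open>Triangle inequalities along the route origin, \<open>u\<close>, \<open>v\<close>, end.
  Each of the two near visits is used on arrival and on departure, which accounts for
  \<open>4 * r\<close>.\<close>

lemma tour_length:
  assumes "a \<in> carrier W" "b \<in> carrier W" "c \<in> carrier W" "u \<in> carrier K" "v \<in> carrier K"
    and "Q.wdist (snd a) u \<le> r" "Q.wdist (snd (a \<otimes>\<^bsub>W\<^esub> b)) v \<le> r"
  shows "Q.len u + Q.wdist u v + Q.wdist v (snd (a \<otimes>\<^bsub>W\<^esub> b \<otimes>\<^bsub>W\<^esub> c)) \<le> W.len a + W.len b + W.len c + 4 * r"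
proof -
  let ?a = "snd a" and ?b = "snd (a \<otimes>\<^bsub>W\<^esub> b)" and ?c = "snd (a \<otimes>\<^bsub>W\<^esub> b \<otimes>\<^bsub>W\<^esub> c)"
  have cl: "?a \<in> carrier K" "?b \<in> carrier K" "?c \<in> carrier K" using assms by auto
  have "Q.len u \<le> Q.len ?a + Q.wdist ?a u"
    using Q.dist_triangle[of "\<one>\<^bsub>K\<^esub>" ?a u] cl assms by (simp add: Q.dist_one)
  moreover have "Q.wdist u v \<le> Q.wdist ?a u + Q.wdist ?a ?b + Q.wdist ?b v"
    using Q.dist_triangle[of u ?a v] Q.dist_triangle[of ?a ?b v] Q.dist_commute[of u ?a] cl assms by linarith
  moreover have "Q.wdist v ?c \<le> Q.wdist ?b v + Q.wdist ?b ?c"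
    using Q.dist_triangle[of v ?b ?c] Q.dist_commute[of v ?b] cl assms by linarith
  moreover have "Q.wdist ?a ?b \<le> W.len b" "Q.wdist ?b ?c \<le> W.len c"
    using len_snd_le assms by (auto simp: Q.dist_mult_right)
  moreover have "Q.len ?a \<le> W.len a" using len_snd_le assms by blast
  ultimately show ?thesis using assms by linarith
qed

text \<open>Any word must visit both lamps; the two disjuncts are the two orders of the
  visits.\<close>

lemma two_lit_length:
  assumes r: "reach r" and g: "g \<in> carrier W" and u: "u \<in> carrier K" "fst g u \<noteq> \<one>\<^bsub>H\<^esub>"
    and v: "v \<in> carrier K" "fst g v \<noteq> \<one>\<^bsub>H\<^esub>"
  shows "Q.len u + Q.wdist u v + Q.wdist v (snd g) \<le> W.len g + 4 * r \<or>
    Q.len v + Q.wdist u v + Q.wdist u (snd g) \<le> W.len g + 4 * r"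
proof -
  obtain a b where ab: "a \<in> carrier W" "b \<in> carrier W" "g = a \<otimes>\<^bsub>W\<^esub> b" "W.len a + W.len b \<le> W.len g"
    "Q.wdist (snd a) v \<le> r" using lit_visit[OF r g order_refl v] by blast
  \<comment> \<open>The cut lies near \<open>v\<close>. If lamp \<open>u\<close> is already lit in
    \<open>a\<close>, then \<open>u\<close> is visited first; otherwise the remainder
    \<open>b\<close> lights it and the order is reversed.\<close>
  show ?thesis
  proof (cases "fst a u = \<one>\<^bsub>H\<^esub>")
    case False
    then obtain c d where cd: "c \<in> carrier W" "d \<in> carrier W" "a = c \<otimes>\<^bsub>W\<^esub> d" "W.len c + W.len d \<le> W.len a"
      "Q.wdist (snd c) u \<le> r" using lit_visit[OF r ab(1) order_refl u(1)] by blast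
    have "Q.len u + Q.wdist u v + Q.wdist v (snd g) \<le> W.len c + W.len d + W.len b + 4 * r"
      using tour_length[of c d b u v r] cd ab u v by simp
    then show ?thesis using ab cd by linarith
  next
    case True
    let ?u = "inv\<^bsub>K\<^esub> (snd a) \<otimes>\<^bsub>K\<^esub> u"
    have u': "?u \<in> carrier K" "fst b ?u \<noteq> \<one>\<^bsub>H\<^esub>" using True ab u by auto
    then obtain c d where cd: "c \<in> carrier W" "d \<in> carrier W" "b = c \<otimes>\<^bsub>W\<^esub> d" "W.len c + W.len d \<le> W.len b"
      "Q.wdist (snd c) ?u \<le> r" using lit_visit[OF r ab(2) order_refl u'] by blast
    have "Q.wdist (snd (a \<otimes>\<^bsub>W\<^esub> c)) u \<le> r" using cd ab u by (simp add: Q.dist_mult_left)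
    moreover have "g = a \<otimes>\<^bsub>W\<^esub> c \<otimes>\<^bsub>W\<^esub> d" using ab cd by (simp add: W.m_assoc)
    ultimately have "Q.len v + Q.wdist v u + Q.wdist u (snd g) \<le> W.len a + W.len c + W.len d + 4 * r"
      using tour_length[of a c d v u r] cd ab u v by simp
    then show ?thesis using ab cd Q.dist_commute[OF u(1) v(1)] by linarith
  qed
qed

section \<open>Elements with a single lamp\<close>

definition lamp_at :: "'k \<Rightarrow> ('k \<Rightarrow> 'h) \<times> 'k \<Rightarrow> bool" where
  "lamp_at v g \<longleftrightarrow> g \<in> carrier W \<and> snd g = \<one>\<^bsub>K\<^esub> \<and> (\<forall>x\<in>carrier K. fst g x \<noteq> \<one>\<^bsub>H\<^esub> \<longleftrightarrow> x = v)"

lemma ex_lamp_at_one: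
  assumes "carrier H \<noteq> {\<one>\<^bsub>H\<^esub>}"
  shows "\<exists>g. lamp_at \<one>\<^bsub>K\<^esub> g"
proof -
  obtain h where h: "h \<in> carrier H" "h \<noteq> \<one>\<^bsub>H\<^esub>" using assms H.one_closed by blast
  have "{x \<in> carrier K. x = \<one>\<^bsub>K\<^esub>} = {\<one>\<^bsub>K\<^esub>}" by auto
  then have "lamp_at \<one>\<^bsub>K\<^esub> ((\<lambda>x\<in>carrier K. if x = \<one>\<^bsub>K\<^esub> then h else \<one>\<^bsub>H\<^esub>), \<one>\<^bsub>K\<^esub>)"
    using h by (auto simp: lamp_at_def carrier_W cong: conj_cong)
  then show ?thesis by blast
qed

text \<open>Conjugation moves the lamp to the cursor of \<open>w\<close>, while the lamps of
  \<open>w\<close> itself cancel up to conjugation in \<open>H\<close>. This may change the value of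
  the lamp but not its nontriviality, hence \<open>lamp_at\<close> leaves the value open.\<close>

lemma lamp_at_conjugate:
  assumes x: "lamp_at \<one>\<^bsub>K\<^esub> x" and w: "w \<in> carrier W"
  shows "lamp_at (snd w) (w \<otimes>\<^bsub>W\<^esub> x \<otimes>\<^bsub>W\<^esub> inv\<^bsub>W\<^esub> w)" (is "lamp_at _ ?g")
proof -
  have xc: "x \<in> carrier W" "snd x = \<one>\<^bsub>K\<^esub>"
    and xs: "\<And>y. y \<in> carrier K \<Longrightarrow> fst x y \<noteq> \<one>\<^bsub>H\<^esub> \<longleftrightarrow> y = \<one>\<^bsub>K\<^esub>"
    using x by (auto simp: lamp_at_def)
  have "fst ?g y \<noteq> \<one>\<^bsub>H\<^esub> \<longleftrightarrow> y = snd w" if y: "y \<in> carrier K" for y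
  proof -
    let ?y = "inv\<^bsub>K\<^esub> (snd w) \<otimes>\<^bsub>K\<^esub> y"
    have yc: "?y \<in> carrier K" using y w by simp
    \<comment> \<open>Reading off lamp \<open>y\<close> of \<open>w\<close> times its inverse
      identifies the lamp of the inverse at \<open>?y\<close>.\<close>
    have "fst (w \<otimes>\<^bsub>W\<^esub> inv\<^bsub>W\<^esub> w) y = \<one>\<^bsub>H\<^esub>" using w y by simp
    then have "fst w y \<otimes>\<^bsub>H\<^esub> fst (inv\<^bsub>W\<^esub> w) ?y = \<one>\<^bsub>H\<^esub>" using y by (simp del: W.r_inv)
    moreover have "fst w y \<in> carrier H" "fst (inv\<^bsub>W\<^esub> w) ?y \<in> carrier H" using w y yc by auto
    ultimately have iy: "fst (inv\<^bsub>W\<^esub> w) ?y = inv\<^bsub>H\<^esub> (fst w y)" by (metis H.inv_equality H.inv_inv H.inv_closed)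
    have "fst ?g y = fst w y \<otimes>\<^bsub>H\<^esub> fst x ?y \<otimes>\<^bsub>H\<^esub> inv\<^bsub>H\<^esub> (fst w y)"
      using w xc y iy by simp
    then have "fst ?g y = \<one>\<^bsub>H\<^esub> \<longleftrightarrow> fst x ?y = \<one>\<^bsub>H\<^esub>"
      using H.conjugate_eq_one_iff[of "fst w y" "fst x ?y"] fst_closed w xc y yc by metis
    moreover have "?y = \<one>\<^bsub>K\<^esub> \<longleftrightarrow> y = snd w"
      using y w by (simp add: K.inv_solve_left')
    ultimately show ?thesis using xs[OF yc] by blast
  qed
  then show ?thesis using w xc by (simp add: lamp_at_def)
qed

text \<open>Disjoint supports. Thanks to this, the two round trips can be made in either
  order.\<close>

lemma lamp_at_commute:
  assumes a: "lamp_at u a" and b: "lamp_at v b" and "u \<noteq> v"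
  shows "a \<otimes>\<^bsub>W\<^esub> b = b \<otimes>\<^bsub>W\<^esub> a"
proof (rule W_eqI)
  fix x assume "x \<in> carrier K"
  then show "fst (a \<otimes>\<^bsub>W\<^esub> b) x = fst (b \<otimes>\<^bsub>W\<^esub> a) x"
    using a b assms(3) by (cases "x = u"; cases "x = v") (auto simp: lamp_at_def)
qed (use a b in \<open>auto simp: lamp_at_def\<close>)

text \<open>\<open>z\<close> is too short to touch the lamps at \<open>u\<close> and
  \<open>v\<close>, so both remain lit and must be visited: \<open>m\<close> to the first and
  \<open>2 * m\<close> across to the second.\<close>

lemma two_lamps_near:
  assumes r: "reach r" and A: "lamp_at u A" and B: "lamp_at v B"
    and u: "u \<in> carrier K" "Q.len u = m" and v: "v \<in> carrier K" "Q.len v = m"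
    and uv: "Q.wdist u v = 2 * m" and m: "0 < m"
    and z: "z \<in> carrier W" "W.len z + r < m"
  shows "3 * m + Q.wdist u (snd z) \<le> W.len (A \<otimes>\<^bsub>W\<^esub> B \<otimes>\<^bsub>W\<^esub> z) + 4 * r \<or>
    3 * m + Q.wdist v (snd z) \<le> W.len (A \<otimes>\<^bsub>W\<^esub> B \<otimes>\<^bsub>W\<^esub> z) + 4 * r"
proof -
  have AB: "A \<in> carrier W" "B \<in> carrier W" "snd A = \<one>\<^bsub>K\<^esub>" "snd B = \<one>\<^bsub>K\<^esub>"
    using A B by (auto simp: lamp_at_def)
  have "u \<noteq> v" using uv m u by (auto simp: word_dist_def)
  then have lit: "fst A u \<noteq> \<one>\<^bsub>H\<^esub>" "fst B u = \<one>\<^bsub>H\<^esub>" "fst A v = \<one>\<^bsub>H\<^esub>" "fst B v \<noteq> \<one>\<^bsub>H\<^esub>"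
    using A B u v unfolding lamp_at_def by auto
  have "fst z u = \<one>\<^bsub>H\<^esub>" using lit_len_ge[OF r z(1) u(1)] z(2) u(2) by linarith
  then have 1: "fst (A \<otimes>\<^bsub>W\<^esub> B \<otimes>\<^bsub>W\<^esub> z) u \<noteq> \<one>\<^bsub>H\<^esub>" using lit AB u by simp
  have "fst z v = \<one>\<^bsub>H\<^esub>" using lit_len_ge[OF r z(1) v(1)] z(2) v(2) by linarith
  then have 2: "fst (A \<otimes>\<^bsub>W\<^esub> B \<otimes>\<^bsub>W\<^esub> z) v \<noteq> \<one>\<^bsub>H\<^esub>" using lit AB v by simp
  have c: "A \<otimes>\<^bsub>W\<^esub> B \<otimes>\<^bsub>W\<^esub> z \<in> carrier W" "snd (A \<otimes>\<^bsub>W\<^esub> B \<otimes>\<^bsub>W\<^esub> z) = snd z" using AB z by simp_all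
  then show ?thesis using two_lit_length[OF r c(1) u(1) 1 v(1) 2] u(2) v(2) uv by auto
qed

text \<open>Lift a geodesic of length \<open>2 * m\<close> and view its two halves from the
  midpoint: \<open>w\<close> is the inverse of the first half and \<open>w'\<close> is the second.
  Neither half exceeds \<open>m\<close> and together they need \<open>2 * m\<close>, so both are
  exact.\<close>

lemma ex_antipodal:
  assumes "infinite (carrier K)"
  obtains w w' where "w \<in> carrier W" "w' \<in> carrier W" "W.len w \<le> m" "W.len w' \<le> m"
    "Q.len (snd w) = m" "Q.len (snd w') = m" "Q.wdist (snd w) (snd w') = 2 * m"
proof -
  obtain y where y: "y \<in> carrier K" "Q.len y = 2 * m" using Q.ex_len[OF assms] by blast
  obtain Y where Y: "Y \<in> carrier W" "snd Y = y" "W.len Y \<le> 2 * m"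
    using lift_len[OF y(1) eq_refl[OF y(2)]] by blast
  have "W.len Y \<le> m + m" using Y(3) by simp
  then obtain a b where ab: "a \<in> carrier W" "b \<in> carrier W" "Y = a \<otimes>\<^bsub>W\<^esub> b" "W.len a \<le> m" "W.len b \<le> m"
    using W.len_split[OF Y(1)] by blast
  have y': "y = snd a \<otimes>\<^bsub>K\<^esub> snd b" using Y ab by simp
  have c: "snd a \<in> carrier K" "snd b \<in> carrier K" using ab by simp_all
  have "2 * m \<le> Q.len (snd a) + Q.len (snd b)" using Q.len_mult[OF c] y(2) y' by simp
  then have l: "Q.len (snd a) = m" "Q.len (snd b) = m"
    using len_snd_le[OF ab(1)] len_snd_le[OF ab(2)] ab(4,5) by linarith+
  have inv: "inv\<^bsub>W\<^esub> a \<in> carrier W" "snd (inv\<^bsub>W\<^esub> a) = inv\<^bsub>K\<^esub> (snd a)" using ab(1) by simp_all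
  show ?thesis
  proof (rule that[OF inv(1) ab(2) _ ab(5) _ l(2)])
    show "W.len (inv\<^bsub>W\<^esub> a) \<le> m" using W.len_inv[OF ab(1)] ab(4) by simp
    show "Q.len (snd (inv\<^bsub>W\<^esub> a)) = m" using Q.len_inv[OF c(1)] l(1) inv(2) by simp
    show "Q.wdist (snd (inv\<^bsub>W\<^esub> a)) (snd b) = 2 * m"
      using inv(2) y(2) y' c by (simp add: word_dist_def)
  qed
qed

text \<open>After at most \<open>R\<close> steps a path from \<open>a\<close> is still in the range
  where every point is near \<open>u\<close> or near \<open>v\<close>. One step moves the cursor by
  at most \<open>\<tau>\<close>, too little to cross the gap, so the path stays near
  \<open>u\<close> and misses \<open>b\<close>.\<close>

lemma not_joined_within:
  assumes U: "\<And>t. t \<in> U \<Longrightarrow> t \<in> carrier W \<and> W.len t \<le> \<tau>"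
    and a: "W.len a \<le> p" "Q.wdist u (snd a) \<le> d" and b: "Q.wdist v (snd b) \<le> d"
    and A: "A \<subseteq> carrier W" and u: "u \<in> carrier K" and v: "v \<in> carrier K"
    and near: "\<And>z. z \<in> A \<Longrightarrow> W.len z \<le> p + R * \<tau> \<Longrightarrow> Q.wdist u (snd z) \<le> d \<or> Q.wdist v (snd z) \<le> d"
    and gap: "2 * d + \<tau> < Q.wdist u v"
  shows "\<not> joined_within W U A R a b"
proof
  assume "joined_within W U A R a b"
  then obtain k f where kR: "k \<le> R" and f: "f 0 = a" "f k = b" "\<forall>i\<le>k. f i \<in> A"
    "\<forall>i<k. f (Suc i) \<in> f i <#\<^bsub>W\<^esub> U" unfolding joined_within_def by blast
  have "W.len (f i) \<le> p + i * \<tau> \<and> Q.wdist u (snd (f i)) \<le> d" if "i \<le> k" for i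
    using that
  proof (induction i)
    case 0
    then show ?case using a f by simp
  next
    case (Suc i)
    then have IH: "W.len (f i) \<le> p + i * \<tau>" "Q.wdist u (snd (f i)) \<le> d" and i: "i < k" by auto
    obtain t where t: "t \<in> U" "f (Suc i) = f i \<otimes>\<^bsub>W\<^esub> t" using f(4) i by (auto simp: l_coset_def)
    have fA: "f i \<in> A" "f (Suc i) \<in> A" using f(3) i by auto
    then have fc: "f i \<in> carrier W" "f (Suc i) \<in> carrier W" using A by auto
    have t': "t \<in> carrier W" "W.len t \<le> \<tau>" using U[OF t(1)] by auto
    have len: "W.len (f (Suc i)) \<le> p + Suc i * \<tau>"
      using W.len_mult[OF fc(1) t'(1)] t(2) t'(2) IH(1) by simp
    also have "\<dots> \<le> p + R * \<tau>" using Suc.prems kR by (meson add_left_mono mult_le_mono1 order_trans)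
    finally consider "Q.wdist u (snd (f (Suc i))) \<le> d" | "Q.wdist v (snd (f (Suc i))) \<le> d"
      using near[OF fA(2)] by blast
    then show ?case
    proof cases
      case 2
      have sc: "snd (f i) \<in> carrier K" "snd (f (Suc i)) \<in> carrier K" using fc by auto
      have "Q.wdist (snd (f i)) (snd (f (Suc i))) \<le> \<tau>"
        using len_snd_le[OF t'(1)] t' t(2) sc(1) by (simp add: Q.dist_mult_right)
      then have False
        using 2 gap IH(2) Q.dist_triangle[OF u sc(1) v] Q.dist_triangle[OF sc(1) sc(2) v]
          Q.dist_commute[OF sc(2) v] by linarith
      then show ?thesis ..
    qed (use len in blast)
  qed
  then have "Q.wdist u (snd b) \<le> d" using f(2) by blast
  moreover have "snd b \<in> carrier K" using f(2,3) A by auto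
  ultimately show False
    using b gap Q.dist_triangle[OF u _ v, of "snd b"] Q.dist_commute[OF v, of "snd b"] by linarith
qed

theorem ex_disconnected_horoball:
  assumes H: "carrier H \<noteq> {\<one>\<^bsub>H\<^esub>}" and K: "infinite (carrier K)" and U: "symmetric_generating_set W U"
  shows "\<exists>P. horoball W S P \<and> \<not> connected_wrt W U P"
proof -
  obtain r where r: "reach r" using ex_reach by blast
  obtain x where x: "lamp_at \<one>\<^bsub>K\<^esub> x" using ex_lamp_at_one[OF H] by blast
  then have xc: "x \<in> carrier W" by (simp add: lamp_at_def)
  define q where "q = W.len x"
  \<comment> \<open>Converts steps in \<open>U\<close> into length with respect to
    \<open>S\<close>.\<close>
  define \<tau> where "\<tau> = Max (W.len ` U)"
  have \<tau>: "t \<in> carrier W \<and> W.len t \<le> \<tau>" if "t \<in> U" for t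
    using U that unfolding \<tau>_def symmetric_generating_set_def by auto
  \<comment> \<open>Chosen so that the radius \<open>d\<close> below equals
    \<open>m - \<tau> - 1\<close>, which gives the gap \<open>2 * d + \<tau> < 2 * m\<close>. It is
    fixed before \<open>R\<close>, since the endpoints come from the ball of radius
    \<open>p\<close>.\<close>
  define p where "p = 2 * q + 4 * r + \<tau> + 1"
  show ?thesis
  proof (rule W.disconnected_horoball_limit[OF U W.finite_len_le[of p]])
    fix R
    \<comment> \<open>Elements of length at most \<open>p + R * \<tau>\<close>, those within
      \<open>R\<close> steps of the endpoints, must be too short to touch the lamps. The summand
      \<open>R\<close> makes the ball radius at least \<open>R\<close>.\<close>
    define m where "m = p + R * \<tau> + r + R + 1"
    obtain w w' where w: "w \<in> carrier W" "w' \<in> carrier W" "W.len w \<le> m" "W.len w' \<le> m"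
      "Q.len (snd w) = m" "Q.len (snd w') = m" "Q.wdist (snd w) (snd w') = 2 * m"
      using ex_antipodal[OF K] by blast
    have pm: "m = p + (m - p)" by (simp add: m_def)
    \<comment> \<open>The endpoints \<open>a\<close> and \<open>b\<close> are initial pieces of
      \<open>w\<close> and \<open>w'\<close>, with cursors within \<open>m - p\<close> of the
      respective lamps.\<close>
    obtain a c where a: "a \<in> carrier W" "c \<in> carrier W" "w = a \<otimes>\<^bsub>W\<^esub> c" "W.len a \<le> p" "W.len c \<le> m - p"
      using W.len_split[OF w(1), of p "m - p"] w(3) pm by metis
    obtain b e where b: "b \<in> carrier W" "e \<in> carrier W" "w' = b \<otimes>\<^bsub>W\<^esub> e" "W.len b \<le> p" "W.len e \<le> m - p"
      using W.len_split[OF w(2), of p "m - p"] w(4) pm by metis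
    let ?u = "snd w" and ?v = "snd w'"
    define A where "A = w \<otimes>\<^bsub>W\<^esub> x \<otimes>\<^bsub>W\<^esub> inv\<^bsub>W\<^esub> w"
    define B where "B = w' \<otimes>\<^bsub>W\<^esub> x \<otimes>\<^bsub>W\<^esub> inv\<^bsub>W\<^esub> w'"
    have u: "?u \<in> carrier K" and v: "?v \<in> carrier K" using w by simp_all
    have lamps: "lamp_at ?u A" "lamp_at ?v B"
      unfolding A_def B_def using lamp_at_conjugate[OF x] w by blast+
    have m0: "0 < m" by (simp add: m_def)
    have AB: "A \<in> carrier W" "B \<in> carrier W" using lamps by (simp_all add: lamp_at_def)
    have "?u \<noteq> ?v" using w(7) m0 u by (auto simp: word_dist_def)
    then have comm: "A \<otimes>\<^bsub>W\<^esub> B = B \<otimes>\<^bsub>W\<^esub> A" using lamp_at_commute[OF lamps] by blast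
    define g where "g = A \<otimes>\<^bsub>W\<^esub> B"
    have g: "g \<in> carrier W" using AB by (simp add: g_def)
    \<comment> \<open>Two round trips of length \<open>2 * m + q\<close> each, less the
      \<open>p\<close> saved on the last return.\<close>
    define n where "n = 4 * m + 2 * q - p"
    have lenA: "W.len A \<le> 2 * m + q" and lenB: "W.len B \<le> 2 * m + q"
      using W.len_conjugate[OF w(1) xc] W.len_conjugate[OF w(2) xc] w(3,4) by (simp_all add: A_def B_def q_def)
    have lenAa: "W.len (A \<otimes>\<^bsub>W\<^esub> a) \<le> m + q + (m - p)"
      using W.len_conjugate_prefix[OF a(1,2) xc] w(3) a(5) unfolding A_def a(3) q_def by linarith
    have lenBb: "W.len (B \<otimes>\<^bsub>W\<^esub> b) \<le> m + q + (m - p)"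
      using W.len_conjugate_prefix[OF b(1,2) xc] w(4) b(5) unfolding B_def b(3) q_def by linarith
    \<comment> \<open>The factors are swapped so that the trip to \<open>?u\<close> comes last,
      since \<open>a\<close> shortens the return from there; for \<open>b\<close> the original order
      is the right one.\<close>
    have "g \<otimes>\<^bsub>W\<^esub> a = B \<otimes>\<^bsub>W\<^esub> (A \<otimes>\<^bsub>W\<^esub> a)" using AB a(1) by (simp add: g_def comm W.m_assoc)
    then have aball: "a \<in> word_ball W S n (inv\<^bsub>W\<^esub> g)"
      using W.len_mult[of B "A \<otimes>\<^bsub>W\<^esub> a"] AB a(1) lenB lenAa pm
      by (simp add: W.mem_word_ball_inv[OF g] n_def)
    have "g \<otimes>\<^bsub>W\<^esub> b = A \<otimes>\<^bsub>W\<^esub> (B \<otimes>\<^bsub>W\<^esub> b)" using AB b(1) by (simp add: g_def W.m_assoc)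
    then have bball: "b \<in> word_ball W S n (inv\<^bsub>W\<^esub> g)"
      using W.len_mult[of A "B \<otimes>\<^bsub>W\<^esub> b"] AB b(1) lenA lenBb pm
      by (simp add: W.mem_word_ball_inv[OF g] n_def)
    \<comment> \<open>What the radius \<open>n\<close> leaves for the final distance after the lower
      bound \<open>3 * m - 4 * r\<close> is spent.\<close>
    define d where "d = m - p + 2 * q + 4 * r"
    have dm: "d + \<tau> + 1 = m" by (simp add: d_def p_def m_def)
    have "\<not> joined_within W U (word_ball W S n (inv\<^bsub>W\<^esub> g)) R a b"
    proof (rule not_joined_within[where \<tau> = \<tau> and p = p and u = ?u and v = ?v and d = d])
      have "Q.wdist (snd a) ?u \<le> m - p"
        using len_snd_le[OF a(2)] a by (simp add: Q.dist_mult_right)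
      then show "Q.wdist ?u (snd a) \<le> d" using Q.dist_commute[OF u, of "snd a"] a(1) by (simp add: d_def)
      have "Q.wdist (snd b) ?v \<le> m - p"
        using len_snd_le[OF b(2)] b by (simp add: Q.dist_mult_right)
      then show "Q.wdist ?v (snd b) \<le> d" using Q.dist_commute[OF v, of "snd b"] b(1) by (simp add: d_def)
      show "2 * d + \<tau> < Q.wdist ?u ?v" using dm w(7) by simp
      fix z assume z: "z \<in> word_ball W S n (inv\<^bsub>W\<^esub> g)" "W.len z \<le> p + R * \<tau>"
      then have zc: "z \<in> carrier W" and zn: "W.len (A \<otimes>\<^bsub>W\<^esub> B \<otimes>\<^bsub>W\<^esub> z) \<le> n"
        by (simp_all add: W.mem_word_ball_inv[OF g] g_def[symmetric])
      have "W.len z + r < m" using z(2) by (simp add: m_def)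
      from two_lamps_near[OF r lamps u w(5) v w(6) w(7) m0 zc this]
      show "Q.wdist ?u (snd z) \<le> d \<or> Q.wdist ?v (snd z) \<le> d"
        using zn pm unfolding n_def d_def by linarith
    qed (use \<tau> a u v in \<open>auto simp: word_ball_def\<close>)
    moreover have "R \<le> n" by (simp add: n_def m_def)
    ultimately show "\<exists>c\<in>carrier W. \<exists>n\<ge>R. \<exists>a\<in>{g \<in> carrier W. W.len g \<le> p}. \<exists>b\<in>{g \<in> carrier W. W.len g \<le> p}.
        a \<in> word_ball W S n c \<and> b \<in> word_ball W S n c \<and> \<not> joined_within W U (word_ball W S n c) R a b"
      using aball bball a(1,4) b(1,4) W.inv_closed[OF g] by blast
  qed
qed

end

theorem theorem1:
  fixes H :: "('h, 'm) monoid_scheme" and K :: "('k, 'n) monoid_scheme"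
    and S T :: "(('k \<Rightarrow> 'h) \<times> 'k) set"
  assumes "finitely_generated_group H" and "carrier H \<noteq> {\<one>\<^bsub>H\<^esub>}"
    and "finitely_generated_group K" and "infinite (carrier K)"
    and "symmetric_generating_set (wreath_product H K) S"
    and "symmetric_generating_set (wreath_product H K) T"
  shows "\<exists>P. horoball (wreath_product H K) S P \<and> \<not> connected_wrt (wreath_product H K) T P"
proof -
  have "group H" "group K" using assms(1,3) by (simp_all add: finitely_generated_group_def)
  then interpret wreath_metric H K S
    using assms(5) group_wreath_product
    by (simp add: wreath_metric_def word_metric_def word_metric_axioms_def)
  show ?thesis using ex_disconnected_horoball assms(2,4,6) by blast
qed

end
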